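(* Let $\psi\in\mathscr{E}(\mathbb{R})$ be a wavelet, let $f\in\mathscr{E}'(\mathbb{R})$, and let $\mu_\alpha=\langle f,x^\alpha\rangle$ ($\alpha=0,1,2,\dots$) be the moment sequence of $f$. Then for every fixed $b\in\mathbb{R}$ and every integer $N\ge 0$, $$\sqrt{a}\,\Big\langle f(ax),\psi\Big(x-\frac{b}{a}\Big)\Big\rangle=\sum_{\alpha=0}^{N}\frac{\mu_\alpha\, D^\alpha\psi(-b/a)}{\alpha!\,a^{\alpha+1/2}}+O\Big(\frac{1}{a^{N+1/2}}\Big)\qquad\text{as } a\to\infty.$$
   Context: $\mathscr{E}(\mathbb{R})$ is the space of all smooth functions on $\mathbb{R}$ with its usual topology (uniform convergence of all derivatives on compact sets), and $\mathscr{E}'(\mathbb{R})$ is its dual, the space of distributions with compact support. $D^\alpha$ is the $\alpha$-th derivative. $\langle\cdot,\cdot\rangle$ is the (bilinear) duality pairing in the variable $x$, and for $a>0$ the dilated distribution $f(ax)$ is defined by $\langle f(ax),\phi(x)\rangle=\frac1a\langle f(x),\phi(x/a)\rangle$. The left-hand side is the continuous wavelet transform $(W_\psi f)(a,b)$ of $f$ with respect to the wavelet $\psi$, formally $\frac{1}{\sqrt a}\int f(x)\,\psi\big(\frac{x-b}{a}\big)\,dx$, $a>0$, $b\in\mathbb{R}$. "Wavelet" here only means the analysing function of this transform; no admissibility condition is specified. *)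

theory Defs
  imports "HOL-Analysis.Analysis" "HOL-Library.Landau_Symbols"
begin

definition D :: "nat \<Rightarrow> (real \<Rightarrow> complex) \<Rightarrow> real \<Rightarrow> complex" where
  "D k \<phi> = ((\<lambda>g x. vector_derivative g (at x)) ^^ k) \<phi>"

definition smooth_functions :: "(real \<Rightarrow> complex) set" where
  "smooth_functions = {\<phi>. \<forall>k x. D k \<phi> differentiable (at x)}"

text \<open>
  The Frechet space of smooth functions, as an abstract topology whose underlying set is
  \<^const>\<open>smooth_functions\<close>. As \<open>K\<close> is compact and \<open>D k \<eta> - D k \<phi>\<close> is continuous, the pointwise strict
  bound on \<open>K\<close> says the same as a strict bound on the supremum, so the subbasis consists of the
  open balls of the seminorms \<open>sup\<^sub>K |D k \<phi>|\<close>, around all centres.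
\<close>

definition smooth_topology :: "(real \<Rightarrow> complex) topology" where
  "smooth_topology = topology_generated_by
     {{\<eta> \<in> smooth_functions. \<forall>x\<in>K. norm (D k \<eta> x - D k \<phi> x) < \<epsilon>} | K k \<phi> \<epsilon>.
        compact K \<and> \<phi> \<in> smooth_functions \<and> \<epsilon> > 0}"

text \<open>
  The values of a functional outside \<^const>\<open>smooth_functions\<close> are unconstrained and irrelevant.
\<close>

definition compact_distributions :: "((real \<Rightarrow> complex) \<Rightarrow> complex) set" where
  "compact_distributions = {f.
     (\<forall>\<phi>\<in>smooth_functions. \<forall>\<eta>\<in>smooth_functions. f (\<lambda>x. \<phi> x + \<eta> x) = f \<phi> + f \<eta>) \<and>
     (\<forall>c. \<forall>\<phi>\<in>smooth_functions. f (\<lambda>x. c * \<phi> x) = c * f \<phi>) \<and>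
     continuous_map smooth_topology euclidean f}"

definition dilate :: "real \<Rightarrow> ((real \<Rightarrow> complex) \<Rightarrow> complex) \<Rightarrow> (real \<Rightarrow> complex) \<Rightarrow> complex" where
  "dilate a f \<phi> = of_real (1 / a) * f (\<lambda>x. \<phi> (x / a))"

definition moment :: "((real \<Rightarrow> complex) \<Rightarrow> complex) \<Rightarrow> nat \<Rightarrow> complex" where
  "moment f \<alpha> = f (\<lambda>x. of_real x ^ \<alpha>)"

lemma topspace_smooth_topology: "topspace smooth_topology = smooth_functions"
proof
  show "topspace smooth_topology \<subseteq> smooth_functions"
    unfolding smooth_topology_def topology_generated_by_topspace by blast
  have "\<eta> \<in> topspace smooth_topology" if "\<eta> \<in> smooth_functions" for \<eta>
    unfolding smooth_topology_def topology_generated_by_topspace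
  proof (rule UnionI)
    show "{\<xi> \<in> smooth_functions. \<forall>x\<in>{}. norm (D 0 \<xi> x - D 0 \<eta> x) < 1} \<in>
        {{\<xi> \<in> smooth_functions. \<forall>x\<in>K. norm (D k \<xi> x - D k \<phi> x) < \<epsilon>} | K k \<phi> \<epsilon>.
          compact K \<and> \<phi> \<in> smooth_functions \<and> \<epsilon> > 0}"
      using that compact_empty zero_less_one by blast
  qed (use that in simp)
  then show "smooth_functions \<subseteq> topspace smooth_topology"
    by blast
qed

end

theory Submission imports Defs begin

text \<open>
  Up to the factor \<open>1 / sqrt a\<close>, the left-hand side is \<open>f\<close> applied to
  \<open>\<phi> x = \<psi> ((x - b) / a)\<close>. For large \<open>a\<close> this function varies slowly: its \<open>k\<close>-th derivative
  carries a factor \<open>1 / a ^ k\<close>. So \<open>\<phi>\<close> is close to its Taylor polynomial at \<open>0\<close>, whose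
  coefficients are \<open>D \<alpha> \<psi> (- b / a) / (fact \<alpha> * a ^ \<alpha>)\<close>, and \<open>f\<close> sends that polynomial to the
  asserted sum of moments.

  What has to be controlled is \<open>f\<close> on the Taylor remainder \<open>R\<close>, and two facts do it.
  Continuity of \<open>f\<close> means that \<open>f\<close> is bounded by finitely many derivatives on one compact
  interval (\<open>compact_distribution_finite_order\<close>). All derivatives of \<open>R\<close> on such an
  interval are in turn bounded by the derivatives of \<open>\<phi>\<close> of order greater than \<open>N\<close>: those of order
  greater than \<open>N\<close> agree with the derivatives of \<open>\<phi>\<close>, and those of order at most \<open>N\<close> vanish at
  \<open>0\<close>, so each of them is recovered from the next by the mean value inequality
  (\<open>vanishing_derivatives_bound\<close>). Together they give \<open>compact_distribution_taylor\<close>: the error of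
  the moment expansion is at most a constant times the size of the derivatives of \<open>\<phi>\<close> of order
  greater than \<open>N\<close> on a fixed interval. For the dilated wavelet these are \<open>O(1 / a ^ (N + 1))\<close>,
  one power of \<open>a\<close> better than the claim.
\<close>

section \<open>Smooth functions and their derivatives\<close>

lemma D_0 [simp]: "D 0 \<phi> = \<phi>"
  by (simp add: D_def)

lemma D_has_vector_derivative:
  assumes "\<phi> \<in> smooth_functions"
  shows "(D k \<phi> has_vector_derivative D (Suc k) \<phi> x) (at x)"
  using assms by (simp add: smooth_functions_def D_def vector_derivative_works[symmetric])

text \<open>
  Iterated vector derivatives are awkward to compute one after the other. It is easier to guess a
  closed form for the whole sequence of derivatives and check that each member is the derivative of
  the one before; smoothness and the value of every \<open>D k\<close> then follow at once. All closure
  properties below are obtained this way.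
\<close>

lemma derivative_sequence:
  assumes "\<And>k x. (g k has_vector_derivative g (Suc k) x) (at x)"
  shows "g 0 \<in> smooth_functions" and "D k (g 0) = g k"
proof -
  have eq: "D k (g 0) = g k" for k
  proof (induction k)
    case (Suc k)
    have "D (Suc k) (g 0) = (\<lambda>x. vector_derivative (D k (g 0)) (at x))"
      by (simp add: D_def)
    with Suc show ?case
      using assms vector_derivative_at by fastforce
  qed simp
  then show "D k (g 0) = g k" .
  show "g 0 \<in> smooth_functions"
    using assms by (auto simp: smooth_functions_def eq intro: differentiableI_vector)
qed

lemma smooth_add:
  assumes "\<phi> \<in> smooth_functions" "\<eta> \<in> smooth_functions"
  shows "(\<lambda>x. \<phi> x + \<eta> x) \<in> smooth_functions"
    and "D k (\<lambda>x. \<phi> x + \<eta> x) = (\<lambda>x. D k \<phi> x + D k \<eta> x)"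
  using derivative_sequence[of "\<lambda>k x. D k \<phi> x + D k \<eta> x"] assms
  by (auto intro!: has_vector_derivative_add D_has_vector_derivative)

lemma smooth_cmult:
  assumes "\<phi> \<in> smooth_functions"
  shows "(\<lambda>x. c * \<phi> x) \<in> smooth_functions"
    and "D k (\<lambda>x. c * \<phi> x) = (\<lambda>x. c * D k \<phi> x)"
  using derivative_sequence[of "\<lambda>k x. c * D k \<phi> x"] assms
  by (auto intro!: has_vector_derivative_mult_right D_has_vector_derivative)

lemma smooth_zero:
  shows "(\<lambda>x. 0) \<in> smooth_functions" and "D k (\<lambda>x. 0) = (\<lambda>x. 0)"
  using derivative_sequence[of "\<lambda>k x. 0"] by auto

lemma smooth_sum:
  assumes "\<And>i. i \<in> I \<Longrightarrow> g i \<in> smooth_functions"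
  shows "(\<lambda>x. \<Sum>i\<in>I. g i x) \<in> smooth_functions"
    and "D k (\<lambda>x. \<Sum>i\<in>I. g i x) = (\<lambda>x. \<Sum>i\<in>I. D k (g i) x)"
proof -
  have "((\<lambda>x. \<Sum>i\<in>I. D k (g i) x) has_vector_derivative (\<Sum>i\<in>I. D (Suc k) (g i) x)) (at x)"
    for k x
    by (intro has_vector_derivative_sum D_has_vector_derivative assms)
  from derivative_sequence[of "\<lambda>k x. \<Sum>i\<in>I. D k (g i) x", OF this]
  show "(\<lambda>x. \<Sum>i\<in>I. g i x) \<in> smooth_functions"
    and "D k (\<lambda>x. \<Sum>i\<in>I. g i x) = (\<lambda>x. \<Sum>i\<in>I. D k (g i) x)"
    by simp_all
qed

lemma smooth_affine:
  assumes "\<phi> \<in> smooth_functions"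
  shows "(\<lambda>x. \<phi> (c * x + d)) \<in> smooth_functions"
    and "D k (\<lambda>x. \<phi> (c * x + d)) = (\<lambda>x. of_real (c ^ k) * D k \<phi> (c * x + d))"
proof -
  have "((\<lambda>x. of_real (c ^ k) * D k \<phi> (c * x + d)) has_vector_derivative
      of_real (c ^ Suc k) * D (Suc k) \<phi> (c * x + d)) (at x)" for k x
  proof -
    have "((\<lambda>x. c * x + d) has_real_derivative c) (at x)"
      by (auto intro!: derivative_eq_intros)
    then have "((\<lambda>x. D k \<phi> (c * x + d)) has_vector_derivative c *\<^sub>R D (Suc k) \<phi> (c * x + d)) (at x)"
      using vector_diff_chain_at[OF _ D_has_vector_derivative[OF assms]]
      by (fastforce simp: o_def has_real_derivative_iff_has_vector_derivative)
    from has_vector_derivative_mult_right[OF this, of "of_real (c ^ k)"] show ?thesis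
      by (simp add: scaleR_conv_of_real algebra_simps)
  qed
  from derivative_sequence[of "\<lambda>k x. of_real (c ^ k) * D k \<phi> (c * x + d)", OF this]
  show "(\<lambda>x. \<phi> (c * x + d)) \<in> smooth_functions"
    and "D k (\<lambda>x. \<phi> (c * x + d)) = (\<lambda>x. of_real (c ^ k) * D k \<phi> (c * x + d))"
    by simp_all
qed

text \<open>
  Truncated subtraction makes the formula uniform in \<open>k\<close>: for \<open>k > n\<close> the product contains the
  factor \<open>n - n\<close>, so that no case distinction is needed.
\<close>

lemma smooth_monomial:
  shows "(\<lambda>x. of_real x ^ n) \<in> smooth_functions"
    and "D k (\<lambda>x. of_real x ^ n) = (\<lambda>x. (\<Prod>i<k. of_nat (n - i)) * of_real x ^ (n - k))"
proof -
  have "((\<lambda>x::real. (\<Prod>i<k. of_nat (n - i)) * of_real x ^ (n - k) :: complex) has_vector_derivative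
      (\<Prod>i<Suc k. of_nat (n - i)) * of_real x ^ (n - Suc k)) (at x)" for k x
  proof -
    have "((\<lambda>z. z ^ (n - k)) has_field_derivative of_nat (n - k) * of_real x ^ (n - Suc k))
        (at (of_real x :: complex))"
      by (auto intro!: derivative_eq_intros)
    from has_vector_derivative_real_field[OF this] 
    have "((\<lambda>x::real. of_real x ^ (n - k) :: complex) has_vector_derivative
      of_nat (n - k) * of_real x ^ (n - Suc k)) (at x)" .
    from has_vector_derivative_mult_right[OF this, of "\<Prod>i<k. of_nat (n - i)"] show ?thesis
      by (simp add: mult.assoc)
  qed
  from derivative_sequence[of "\<lambda>k x. (\<Prod>i<k. of_nat (n - i)) * of_real x ^ (n - k)", OF this]
  show "(\<lambda>x. of_real x ^ n) \<in> smooth_functions"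
    and "D k (\<lambda>x. of_real x ^ n) = (\<lambda>x. (\<Prod>i<k. of_nat (n - i)) * of_real x ^ (n - k))"
    by simp_all
qed

lemma D_monomial_at_0: "D k (\<lambda>x. of_real x ^ n) 0 = (if k = n then fact n else 0)"
proof -
  have "(\<Prod>i<k. of_nat (n - i) :: complex) = 0" if "n < k"
    using that by (intro prod_zero) auto
  moreover have "(\<Prod>i<n. of_nat (n - i) :: complex) = fact n"
    by (simp add: fact_prod_rev atLeast0LessThan)
  ultimately show ?thesis
    by (auto simp: smooth_monomial power_0_left)
qed

lemma D_monomial_high:
  assumes "n < k"
  shows "D k (\<lambda>x. of_real x ^ n) = (\<lambda>x. 0)"
proof -
  have "(\<Prod>i<k. of_nat (n - i) :: complex) = 0"
    using assms by (intro prod_zero) auto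
  then show ?thesis
    by (simp only: smooth_monomial mult_zero_left)
qed

lemma continuous_on_D:
  assumes "\<phi> \<in> smooth_functions"
  shows "continuous_on S (D k \<phi>)"
  using D_has_vector_derivative[OF assms] 
  by (meson continuous_at_imp_continuous_on has_vector_derivative_continuous)

lemma D_bounded_on_compact:
  assumes "\<phi> \<in> smooth_functions" "compact K"
  shows "\<exists>B>0. \<forall>k\<le>m. \<forall>x\<in>K. norm (D k \<phi> x) \<le> B"
proof (induction m)
  case 0
  have "compact (D 0 \<phi> ` K)"
    using assms by (intro compact_continuous_image continuous_on_D)
  then show ?case
    using bounded_pos[of "D 0 \<phi> ` K"] compact_imp_bounded by fastforce
next
  case (Suc m)
  then obtain B where B: "B > 0" "\<forall>k\<le>m. \<forall>x\<in>K. norm (D k \<phi> x) \<le> B"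
    by blast
  have "compact (D (Suc m) \<phi> ` K)"
    using assms by (intro compact_continuous_image continuous_on_D)
  then obtain B' where B': "\<forall>x\<in>K. norm (D (Suc m) \<phi> x) \<le> B'"
    using bounded_pos[of "D (Suc m) \<phi> ` K"] compact_imp_bounded by fastforce
  show ?case
  proof (intro exI conjI allI impI ballI)
    fix k x assume "k \<le> Suc m" "x \<in> K"
    then show "norm (D k \<phi> x) \<le> max B B'"
      using B B' by (cases "k = Suc m") (auto simp: le_max_iff_disj le_Suc_eq)
  qed (use B in simp)
qed

section \<open>Distributions of compact support have finite order\<close>

text \<open>
  The topology is given by a subbasis of balls around arbitrary centres, for single seminorms. The
  lemma turns it into a usable basis of neighbourhoods of zero. Intersections of
  subbasic sets are handled by enlarging the interval and the order and shrinking the radius, which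
  is why the condition ranges over all orders up to \<open>m\<close> and over symmetric intervals.
\<close>

lemma open_neighbourhood_of_zero:
  assumes "openin smooth_topology U" "(\<lambda>x. 0) \<in> U"
  shows "\<exists>r m \<epsilon>. r \<ge> 1 \<and> \<epsilon> > 0 \<and>
    (\<forall>\<phi>\<in>smooth_functions. (\<forall>k\<le>m. \<forall>x\<in>{-r..r}. norm (D k \<phi> x) < \<epsilon>) \<longrightarrow> \<phi> \<in> U)"
    (is "?nhd U")
proof -
  let ?S = "{{\<eta> \<in> smooth_functions. \<forall>x\<in>K. norm (D k \<eta> x - D k \<phi> x) < \<epsilon>} | K k \<phi> \<epsilon>.
        compact K \<and> \<phi> \<in> smooth_functions \<and> \<epsilon> > 0}"
  have "generate_topology_on ?S U"
    using assms by (simp add: smooth_topology_def openin_topology_generated_by_iff)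
  then show ?thesis
    using assms(2)
  proof (induction rule: generate_topology_on.induct)
    case Empty
    then show ?case by simp
  next
    case (Int U V)
    from Int.IH(1) Int.prems obtain r m \<epsilon> where U: "r \<ge> 1" "\<epsilon> > 0"
      "\<And>\<phi>. \<phi> \<in> smooth_functions \<Longrightarrow> (\<forall>k\<le>m. \<forall>x\<in>{-r..r}. norm (D k \<phi> x) < \<epsilon>) \<Longrightarrow> \<phi> \<in> U"
      by blast
    from Int.IH(2) Int.prems obtain r' m' \<epsilon>' where V: "r' \<ge> 1" "\<epsilon>' > 0"
      "\<And>\<phi>. \<phi> \<in> smooth_functions \<Longrightarrow> (\<forall>k\<le>m'. \<forall>x\<in>{-r'..r'}. norm (D k \<phi> x) < \<epsilon>') \<Longrightarrow> \<phi> \<in> V"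
      by blast
    show ?case
    proof (intro exI conjI ballI impI)
      fix \<phi> assume \<phi>: "\<phi> \<in> smooth_functions" and
        less: "\<forall>k\<le>max m m'. \<forall>x\<in>{-max r r'..max r r'}. norm (D k \<phi> x) < min \<epsilon> \<epsilon>'"
      have less: "norm (D k \<phi> x) < \<epsilon> \<and> norm (D k \<phi> x) < \<epsilon>'"
        if "k \<le> m \<or> k \<le> m'" "x \<in> {-r..r} \<or> x \<in> {-r'..r'}" for k x
        using less that by (auto simp: le_max_iff_disj minus_max_eq_min min_le_iff_disj)
      show "\<phi> \<in> U \<inter> V"
        using less by (intro IntI U(3) V(3) \<phi>) blast+
    qed (use U V in auto)
  next
    case (UN \<U>)
    then obtain U where "U \<in> \<U>" "(\<lambda>x. 0) \<in> U"
      by blast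
    with UN.IH[of U] obtain r m \<epsilon> where "r \<ge> 1" "\<epsilon> > 0"
      "\<forall>\<phi>\<in>smooth_functions. (\<forall>k\<le>m. \<forall>x\<in>{-r..r}. norm (D k \<phi> x) < \<epsilon>) \<longrightarrow> \<phi> \<in> U"
      by blast
    then show ?case
      using \<open>U \<in> \<U>\<close> by (intro exI[of _ r] exI[of _ m] exI[of _ \<epsilon>]) blast
  next
    case (Basis U)
    then obtain K k \<phi> \<epsilon> where U: "U = {\<eta> \<in> smooth_functions. \<forall>x\<in>K. norm (D k \<eta> x - D k \<phi> x) < \<epsilon>}"
      and K: "compact K" and \<phi>: "\<phi> \<in> smooth_functions" and "\<epsilon> > 0"
      by blast
    have less: "norm (D k \<phi> x) < \<epsilon>" if "x \<in> K" for x
      using Basis that by (auto simp: U smooth_zero)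
    \<comment> \<open>The ball need not be centred at zero: the room left is \<open>\<epsilon>\<close> minus the maximum of \<open>\<bar>D k \<phi>\<bar>\<close> on \<open>K\<close>.\<close>
    obtain \<delta> where \<delta>: "\<delta> > 0" "\<And>x. x \<in> K \<Longrightarrow> norm (D k \<phi> x) + \<delta> \<le> \<epsilon>"
    proof (cases "K = {}")
      case True
      then show ?thesis using that[of 1] by simp
    next
      case False
      have "continuous_on K (\<lambda>x. norm (D k \<phi> x))"
        by (intro continuous_intros continuous_on_D \<phi>)
      from continuous_attains_sup[OF K False this] obtain y
        where "y \<in> K" "\<And>x. x \<in> K \<Longrightarrow> norm (D k \<phi> x) \<le> norm (D k \<phi> y)"
        by blast
      then show ?thesis
        using that[of "\<epsilon> - norm (D k \<phi> y)"] less[of y] by fastforce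
    qed
    obtain r where r: "r > 0" "\<And>x. x \<in> K \<Longrightarrow> norm x \<le> r"
      using compact_imp_bounded[OF K] unfolding bounded_pos by auto
    show ?case
    proof (intro exI conjI ballI impI)
      fix \<eta> assume \<eta>: "\<eta> \<in> smooth_functions"
        "\<forall>j\<le>k. \<forall>x\<in>{- max r 1..max r 1}. norm (D j \<eta> x) < \<delta>"
      have "norm (D k \<eta> x - D k \<phi> x) < \<epsilon>" if "x \<in> K" for x
      proof -
        have "x \<in> {- max r 1..max r 1}"
          using r(2)[OF that] by auto
        then have "norm (D k \<eta> x) < \<delta>"
          using \<eta> by blast
        then show ?thesis
          using \<delta>(2)[OF that] norm_triangle_ineq4[of "D k \<eta> x" "D k \<phi> x"] by linarith
      qed
      then show "\<eta> \<in> U"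
        using \<eta> by (simp add: U)
    qed (use \<delta> in auto)
  qed
qed

text \<open>
  The preimage of the unit ball contains a neighbourhood of zero; by linearity any smooth function
  can be rescaled into that neighbourhood. Taking \<open>r \<ge> 1\<close> makes powers of \<open>r\<close> increase with the
  exponent when the mean value inequality is iterated.
\<close>

lemma compact_distribution_finite_order:
  assumes "f \<in> compact_distributions"
  obtains C r m where "C > 0" "r \<ge> 1"
    "\<forall>\<phi>\<in>smooth_functions. \<forall>s>0.
       (\<forall>k\<le>m. \<forall>x. \<bar>x\<bar> \<le> r \<longrightarrow> norm (D k \<phi> x) \<le> s) \<longrightarrow> norm (f \<phi>) \<le> C * s"
proof -
  have cmult: "f (\<lambda>x. c * \<phi> x) = c * f \<phi>" if "\<phi> \<in> smooth_functions" for c \<phi>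
    using assms that by (simp add: compact_distributions_def)
  have cont: "continuous_map smooth_topology euclidean f"
    using assms by (simp add: compact_distributions_def)
  have "f (\<lambda>x. 0) = 0"
    using cmult[OF smooth_zero(1), of 0] by simp
  then have zero: "(\<lambda>x. 0) \<in> {\<phi> \<in> smooth_functions. f \<phi> \<in> ball 0 1}"
    by (simp add: smooth_zero)
  have "openin smooth_topology {\<phi> \<in> smooth_functions. f \<phi> \<in> ball 0 1}"
    using openin_continuous_map_preimage[OF cont, of "ball 0 1"] 
    by (simp add: topspace_smooth_topology)
  from open_neighbourhood_of_zero[OF this zero] obtain r m \<epsilon> where "r \<ge> 1" and \<epsilon>: "\<epsilon> > 0" and
    nhd: "\<And>\<phi>. \<phi> \<in> smooth_functions \<Longrightarrow> (\<forall>k\<le>m. \<forall>x\<in>{-r..r}. norm (D k \<phi> x) < \<epsilon>)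
            \<Longrightarrow> norm (f \<phi>) < 1"
    by (simp del: atLeastAtMost_iff) blast
  have "norm (f \<phi>) \<le> 2 / \<epsilon> * s"
    if \<phi>: "\<phi> \<in> smooth_functions" and s: "s > 0"
      and le: "\<And>k x. k \<le> m \<Longrightarrow> \<bar>x\<bar> \<le> r \<Longrightarrow> norm (D k \<phi> x) \<le> s" for \<phi> s
  proof -
    \<comment> \<open>The factor \<open>2\<close> turns the bound \<open>s\<close> into the strict bound that the neighbourhood demands.\<close>
    define c where "c = \<epsilon> / (2 * s)"
    have c: "c > 0" using s \<epsilon> by (simp add: c_def)
    have "norm (D k (\<lambda>x. of_real c * \<phi> x) x) < \<epsilon>" if "k \<le> m" "\<bar>x\<bar> \<le> r" for k x
    proof -
      have "norm (D k (\<lambda>x. of_real c * \<phi> x) x) = c * norm (D k \<phi> x)"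
        using c by (simp add: smooth_cmult[OF \<phi>] norm_mult)
      also have "\<dots> \<le> c * s"
        using le[OF that] c by simp
      also have "\<dots> < \<epsilon>"
        using \<epsilon> s by (simp add: c_def)
      finally show ?thesis .
    qed
    then have "norm (f (\<lambda>x. of_real c * \<phi> x)) < 1"
      by (intro nhd smooth_cmult \<phi>) auto
    then have "c * norm (f \<phi>) < 1"
      using c by (simp add: cmult[OF \<phi>] norm_mult)
    then show ?thesis
      using s \<epsilon> by (simp add: c_def field_simps)
  qed
  then show ?thesis
    using that[of "2 / \<epsilon>" r m] \<epsilon> \<open>r \<ge> 1\<close> by simp
qed

section \<open>Taylor expansion under a distribution\<close>

text \<open>
  The remainder is written as a sum with negated coefficients so that the rules for sums and scalar
  multiples apply to it as it stands.
\<close>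

lemma taylor_remainder_derivatives:
  fixes \<phi> :: "real \<Rightarrow> complex" and N :: nat
  assumes "\<phi> \<in> smooth_functions"
  defines "R \<equiv> \<lambda>x. \<phi> x + (\<Sum>n\<le>N. - (D n \<phi> 0 / fact n) * of_real x ^ n)"
  shows "R \<in> smooth_functions"
    and "k \<le> N \<Longrightarrow> D k R 0 = 0"
    and "N < k \<Longrightarrow> D k R = D k \<phi>"
proof -
  have terms: "(\<lambda>x. - (D n \<phi> 0 / fact n) * of_real x ^ n) \<in> smooth_functions" for n
    by (intro smooth_cmult smooth_monomial)
  show "R \<in> smooth_functions"
    unfolding R_def by (intro smooth_add smooth_sum assms terms)
  have DR: "D k R x = D k \<phi> x + (\<Sum>n\<le>N. - (D n \<phi> 0 / fact n) * D k (\<lambda>x. of_real x ^ n) x)" for x k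
    unfolding R_def by (simp only: smooth_add(2) smooth_sum assms terms smooth_cmult(2) smooth_monomial(1))
  show "D k R 0 = 0" if "k \<le> N"
  proof -
    have "(\<Sum>n\<le>N. - (D n \<phi> 0 / fact n) * D k (\<lambda>x. of_real x ^ n) 0) = (\<Sum>n\<le>N. if k = n then - D k \<phi> 0 else 0)"
      by (intro sum.cong) (auto simp: D_monomial_at_0)
    also have "\<dots> = - D k \<phi> 0"
      using that by simp
    finally show ?thesis
      unfolding DR by simp
  qed
  show "D k R = D k \<phi>" if "N < k"
    using that by (auto simp: DR D_monomial_high)
qed

text \<open>
  Downward induction on the order: a derivative that vanishes at \<open>0\<close> is bounded on
  \<open>[-r, r]\<close> by \<open>r\<close> times the bound on the next one. This bounds every derivative of a Taylor
  remainder and not only its values, as the seminorms of the distribution require.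
\<close>

lemma vanishing_derivatives_bound:
  assumes R: "R \<in> smooth_functions" and zero: "\<And>k. k \<le> N \<Longrightarrow> D k R 0 = 0"
    and top: "\<And>x. \<bar>x\<bar> \<le> r \<Longrightarrow> norm (D (Suc N) R x) \<le> s"
    and "j \<le> Suc N" "\<bar>x\<bar> \<le> r"
  shows "norm (D (Suc N - j) R x) \<le> s * r ^ j"
  using assms(4,5)
proof (induction j arbitrary: x)
  case 0
  then show ?case using top by simp
next
  case (Suc j)
  have "norm (D (N - j) R x - D (N - j) R 0) \<le> s * r ^ j * norm (x - 0)"
  proof (rule differentiable_bound)
    show "convex {-r..r}" by simp
    fix y assume "y \<in> {-r..r}"
    then have y: "\<bar>y\<bar> \<le> r" by auto
    show "(D (N - j) R has_derivative (\<lambda>h. h *\<^sub>R D (Suc (N - j)) R y)) (at y within {-r..r})"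
      using D_has_vector_derivative[OF R] 
      by (simp add: has_vector_derivative_def has_derivative_at_withinI)
    have "norm (D (Suc (N - j)) R y) \<le> s * r ^ j"
      using Suc.IH[of y] Suc.prems y by (simp add: Suc_diff_le)
    then show "onorm (\<lambda>h. h *\<^sub>R D (Suc (N - j)) R y) \<le> s * r ^ j"
      by (intro onorm_le) (simp add: mult.commute mult_left_mono)
  qed (use Suc.prems in auto)
  also have "\<dots> \<le> s * r ^ j * r"
  proof -
    have "0 \<le> s * r ^ j"
      using Suc.IH[of x] Suc.prems norm_ge_zero order_trans by (metis Suc_leD)
    then show ?thesis
      using Suc.prems by (intro mult_left_mono) auto
  qed
  finally show ?case
    using zero[of "N - j"] by (simp add: mult_ac)
qed

text \<open>
  The remainder estimate of Taylor's theorem, transported through \<open>f\<close>. The constants depend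
  on \<open>f\<close> and \<open>N\<close> only; this uniformity in \<open>\<phi>\<close> is what allows \<open>\<phi>\<close> to depend on the dilation
  parameter.
\<close>

lemma compact_distribution_taylor:
  assumes f: "f \<in> compact_distributions"
  obtains C r M where "C > 0" "r > 0"
    "\<forall>\<phi>\<in>smooth_functions. \<forall>s>0.
       (\<forall>k\<in>{N<..M}. \<forall>x. \<bar>x\<bar> \<le> r \<longrightarrow> norm (D k \<phi> x) \<le> s) \<longrightarrow>
       norm (f \<phi> - (\<Sum>n\<le>N. D n \<phi> 0 / fact n * moment f n)) \<le> C * s"
proof -
  obtain C r m where "C > 0" and r: "r \<ge> 1" and bound:
    "\<forall>\<phi>\<in>smooth_functions. \<forall>s>0.
       (\<forall>k\<le>m. \<forall>x. \<bar>x\<bar> \<le> r \<longrightarrow> norm (D k \<phi> x) \<le> s) \<longrightarrow> norm (f \<phi>) \<le> C * s"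
    by (rule compact_distribution_finite_order[OF f])
  have add: "f (\<lambda>x. \<phi> x + \<eta> x) = f \<phi> + f \<eta>"
    if "\<phi> \<in> smooth_functions" "\<eta> \<in> smooth_functions" for \<phi> \<eta>
    using f that by (simp add: compact_distributions_def)
  have cmult: "f (\<lambda>x. c * \<phi> x) = c * f \<phi>" if "\<phi> \<in> smooth_functions" for c \<phi>
    using f that by (simp add: compact_distributions_def)
  have poly: "f (\<lambda>x. \<Sum>n\<in>I. c n * of_real x ^ n) = (\<Sum>n\<in>I. c n * moment f n)"
    if "finite I" for I :: "nat set" and c
    using that
  proof (induction I)
    case empty
    then show ?case
      using cmult[OF smooth_zero(1), of 0] by simp
  next
    case (insert n I)
    then show ?case
      by (simp add: add cmult smooth_cmult smooth_sum smooth_monomial moment_def)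
  qed
  have "norm (f \<phi> - (\<Sum>n\<le>N. D n \<phi> 0 / fact n * moment f n)) \<le> C * r ^ Suc N * s"
    if \<phi>: "\<phi> \<in> smooth_functions" and s: "s > 0"
      and le: "\<And>k x. N < k \<Longrightarrow> k \<le> max m (Suc N) \<Longrightarrow> \<bar>x\<bar> \<le> r \<Longrightarrow> norm (D k \<phi> x) \<le> s" for \<phi> s
  proof -
    define R where "R = (\<lambda>x. \<phi> x + (\<Sum>n\<le>N. - (D n \<phi> 0 / fact n) * of_real x ^ n))"
    note R = taylor_remainder_derivatives[OF \<phi>, where N = N, folded R_def]
    have "norm (D k R x) \<le> s * r ^ Suc N" if "k \<le> m" "\<bar>x\<bar> \<le> r" for k x
    proof (cases "N < k")
      case True
      then have "norm (D k R x) \<le> s"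
        using R(3) le that by simp
      also have "\<dots> \<le> s * r ^ Suc N"
        using s r one_le_power[OF r, of "Suc N"] by simp
      finally show ?thesis .
    next
      case False
      have "norm (D (Suc N - (Suc N - k)) R x) \<le> s * r ^ (Suc N - k)"
        using le R that by (intro vanishing_derivatives_bound[where r = r]) auto
      also have "\<dots> \<le> s * r ^ Suc N"
        using s r by (intro mult_left_mono power_increasing) auto
      finally show ?thesis
        using False by simp
    qed
    then have "norm (f R) \<le> C * (s * r ^ Suc N)"
      using s r R(1) by (intro bound[rule_format]) auto
    moreover have "f R = f \<phi> - (\<Sum>n\<le>N. D n \<phi> 0 / fact n * moment f n)"
    proof -
      have "f R = f \<phi> + f (\<lambda>x. \<Sum>n\<le>N. - (D n \<phi> 0 / fact n) * of_real x ^ n)"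
        unfolding R_def by (intro add \<phi> smooth_sum smooth_cmult smooth_monomial)
      also have "\<dots> = f \<phi> + (\<Sum>n\<le>N. - (D n \<phi> 0 / fact n) * moment f n)"
        by (subst poly) simp_all
      finally show ?thesis
        by (simp add: sum_negf)
    qed
    ultimately show ?thesis
      by (simp add: algebra_simps)
  qed
  then show ?thesis
    \<comment> \<open>Order \<open>N + 1\<close> starts the mean value induction, even when \<open>f\<close> has smaller order \<open>m\<close>.\<close>
    using that[of "C * r ^ Suc N" r "max m (Suc N)"] \<open>C > 0\<close> r by simp
qed

section \<open>The asymptotic expansion of the wavelet transform\<close>

theorem theorem2p2:
  fixes \<psi> :: "real \<Rightarrow> complex" and f :: "(real \<Rightarrow> complex) \<Rightarrow> complex"
    and b :: real and N :: nat
  assumes "\<psi> \<in> smooth_functions" and "f \<in> compact_distributions"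
  shows "(\<lambda>a::real. of_real (sqrt a) * dilate a f (\<lambda>x. \<psi> (x - b / a))
            - (\<Sum>\<alpha>=0..N. moment f \<alpha> * D \<alpha> \<psi> (- b / a)
                 / (fact \<alpha> * of_real (a powr (real \<alpha> + 1 / 2)))))
         \<in> O[at_top](\<lambda>a. of_real (1 / a powr (real N + 1 / 2)))"
proof -
  obtain C r M where C: "C > 0" and r: "r > 0" and taylor:
    "\<forall>\<phi>\<in>smooth_functions. \<forall>s>0.
       (\<forall>k\<in>{N<..M}. \<forall>x. \<bar>x\<bar> \<le> r \<longrightarrow> norm (D k \<phi> x) \<le> s) \<longrightarrow>
       norm (f \<phi> - (\<Sum>n\<le>N. D n \<phi> 0 / fact n * moment f n)) \<le> C * s"
    by (rule compact_distribution_taylor[OF assms(2), where N = N])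
  \<comment> \<open>For \<open>a \<ge> 1\<close> and \<open>\<bar>x\<bar> \<le> r\<close> the argument \<open>(x - b) / a\<close> of \<open>\<psi>\<close> stays in \<open>[-L, L]\<close>, whatever \<open>a\<close> is.\<close>
  define L where "L = r + \<bar>b\<bar>"
  obtain B where B: "B > 0" "\<And>k y. k \<le> M \<Longrightarrow> y \<in> {-L..L} \<Longrightarrow> norm (D k \<psi> y) \<le> B"
    using D_bounded_on_compact[OF assms(1), of "{-L..L}" M] by auto
  show ?thesis
  proof (rule bigoI[of _ "C * B"])
    show "\<forall>\<^sub>F a in at_top. norm (of_real (sqrt a) * dilate a f (\<lambda>x. \<psi> (x - b / a))
            - (\<Sum>\<alpha>=0..N. moment f \<alpha> * D \<alpha> \<psi> (- b / a)
                 / (fact \<alpha> * of_real (a powr (real \<alpha> + 1 / 2)))))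
          \<le> C * B * norm (of_real (1 / a powr (real N + 1 / 2)) :: complex)"
      using eventually_ge_at_top[of "1::real"]
    proof eventually_elim
      case (elim a)
      then have a: "a > 0" by simp
      define \<phi> where "\<phi> = (\<lambda>x. \<psi> (1 / a * x + - b / a))"
      have \<phi>: "\<phi> \<in> smooth_functions"
        and D\<phi>: "\<And>k x. D k \<phi> x = of_real ((1 / a) ^ k) * D k \<psi> (1 / a * x + - b / a)"
        unfolding \<phi>_def by (simp_all only: smooth_affine[OF assms(1)])
      have bound: "norm (D k \<phi> x) \<le> B / a ^ Suc N" if "N < k" "k \<le> M" "\<bar>x\<bar> \<le> r" for k x
      proof -
        have "\<bar>x - b\<bar> / a \<le> \<bar>x - b\<bar>"
          using elim mult_right_mono[of 1 a "\<bar>x - b\<bar>"] by (simp add: field_simps)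
        then have "\<bar>1 / a * x + - b / a\<bar> \<le> L"
          using that a by (simp add: L_def diff_divide_distrib[symmetric])
        then have "1 / a * x + - b / a \<in> {-L..L}"
          unfolding atLeastAtMost_iff abs_le_iff by linarith
        from B(2)[OF that(2) this] have "norm (D k \<phi> x) \<le> (1 / a) ^ k * B"
          using a unfolding D\<phi> norm_mult norm_of_real by (simp add: mult_left_mono)
        also have "\<dots> \<le> (1 / a) ^ Suc N * B"
          using that elim B(1) by (intro mult_right_mono power_decreasing) auto
        finally show ?thesis
          by (simp add: power_divide)
      qed
      have half: "sqrt a / a = 1 / a powr (1 / 2)"
        using a by (simp add: powr_half_sqrt field_simps)
      have powr_split: "a powr (real n + 1 / 2) = a ^ n * a powr (1 / 2)" for n
        using a by (simp add: powr_add powr_realpow)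
      have dil: "of_real (sqrt a) * dilate a f (\<lambda>x. \<psi> (x - b / a)) = of_real (1 / a powr (1 / 2)) * f \<phi>"
        unfolding dilate_def \<phi>_def half[symmetric] by simp
      have poly: "(\<Sum>\<alpha>=0..N. moment f \<alpha> * D \<alpha> \<psi> (- b / a)
                 / (fact \<alpha> * of_real (a powr (real \<alpha> + 1 / 2))))
          = of_real (1 / a powr (1 / 2)) * (\<Sum>n\<le>N. D n \<phi> 0 / fact n * moment f n)"
        unfolding sum_distrib_left atLeast0AtMost powr_split
        by (intro sum.cong) (simp_all add: D\<phi> power_divide mult_ac)
      have "norm (of_real (sqrt a) * dilate a f (\<lambda>x. \<psi> (x - b / a))
            - (\<Sum>\<alpha>=0..N. moment f \<alpha> * D \<alpha> \<psi> (- b / a)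
                 / (fact \<alpha> * of_real (a powr (real \<alpha> + 1 / 2)))))
          = 1 / a powr (1 / 2) * norm (f \<phi> - (\<Sum>n\<le>N. D n \<phi> 0 / fact n * moment f n))"
        unfolding dil poly right_diff_distrib[symmetric] norm_mult norm_of_real by simp
      also have "\<dots> \<le> 1 / a powr (1 / 2) * (C * (B / a ^ Suc N))"
        using B(1) a by (intro mult_left_mono taylor[rule_format] \<phi> bound) auto
      also have "\<dots> \<le> 1 / a powr (1 / 2) * (C * (B / a ^ N))"
        using B(1) C elim
        by (intro mult_left_mono divide_left_mono power_increasing) auto
      also have "\<dots> = C * B * norm (of_real (1 / a powr (real N + 1 / 2)) :: complex)"
        using a unfolding powr_split norm_of_real by (simp add: abs_mult)
      finally show ?case .
    qed
  qed
qed

end
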